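(* Let $\gamma=1-\varepsilon\widetilde\gamma$ with $\widetilde\gamma>\pi$. Then, for $\varepsilon>0$ sufficiently small, the largest eigenvalue of the operator $L^1(\varepsilon;1-\varepsilon\widetilde\gamma)$ is strictly negative and the largest eigenvalue of the operator $L^3(\varepsilon;1-\varepsilon\widetilde\gamma)$ is strictly positive.
   Context: Let $\theta_n=0$ for $n\le0$ and $\theta_n=-\pi$ for $n\ge1$. The discrete $0$-$\pi$ sine-Gordon equation with coupling $\varepsilon$ and bias current $\gamma$ is $\ddot\phi_n-\varepsilon[\phi_{n-1}-2\phi_n+\phi_{n+1}]=-\sin(\phi_n+\theta_n)+\gamma$, $n\in\mathbb Z$. For fixed $\widetilde\gamma>\pi$, $\gamma=1-\varepsilon\widetilde\gamma$ and $\varepsilon$ small, there are two monotone steady states, type 1 and type 3, denoted $\Phi^{1}_\pi$ and $\Phi^3_\pi(n;\varepsilon;1-\varepsilon\widetilde\gamma)$, characterized by the expansions $$\Phi^{1/3}_\pi(n;\varepsilon;1-\varepsilon\widetilde\gamma)=\begin{cases}\frac\pi2-\sqrt{\varepsilon}\sqrt{2\widetilde\gamma}+{\cal O}(\varepsilon),&n\le-1,\\ \frac\pi2\mp\sqrt\varepsilon\sqrt{2(\widetilde\gamma-\pi)}+{\cal O}(\varepsilon),&n=0,\\ \frac{3\pi}2-\sqrt\varepsilon\sqrt{2(\widetilde\gamma+\pi)}+{\cal O}(\varepsilon),&n=1,\\ \frac{3\pi}2-\sqrt\varepsilon\sqrt{2\widetilde\gamma}+{\cal O}(\varepsilon),&n\ge2,\end{cases}$$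 with the minus sign at $n=0$ for type 1 and the plus sign for type 3. For $i=1,3$ the linearization is the operator on sequences $\nu=(v_n)_{n\in\mathbb Z}$, $$(L^i(\varepsilon;\gamma)\nu)_n=\varepsilon(v_{n-1}-2v_n+v_{n+1})-\cos\big(\Phi^i_\pi(n;\varepsilon;\gamma)+\theta_n\big)v_n ,$$ and $\Lambda$ is an eigenvalue if $L^i\nu=\Lambda\nu$ for a nonzero $\nu$ decaying as $|n|\to\infty$. *)

theory Defs
  imports Complex_Main
begin

text \<open>Bi-infinite sequences (lattice states) are functions of type \<^typ>\<open>int \<Rightarrow> real\<close>.\<close>

definition theta :: "int \<Rightarrow> real" where
  "theta n = (if n \<le> 0 then 0 else - pi)"

definition laplacian :: "(int \<Rightarrow> real) \<Rightarrow> int \<Rightarrow> real" where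
  "laplacian v n = v (n - 1) - 2 * v n + v (n + 1)"

definition sine_gordon_solution :: "real \<Rightarrow> real \<Rightarrow> (int \<Rightarrow> real \<Rightarrow> real) \<Rightarrow> bool" where
  "sine_gordon_solution \<epsilon> \<gamma> \<phi> \<longleftrightarrow>
     (\<exists>\<phi>' \<phi>''. \<forall>n t.
        (\<phi> n has_real_derivative \<phi>' n t) (at t) \<and>
        (\<phi>' n has_real_derivative \<phi>'' n t) (at t) \<and>
        \<phi>'' n t - \<epsilon> * laplacian (\<lambda>m. \<phi> m t) n = - sin (\<phi> n t + theta n) + \<gamma>)"

definition steady_state :: "real \<Rightarrow> real \<Rightarrow> (int \<Rightarrow> real) \<Rightarrow> bool" where
  "steady_state \<epsilon> \<gamma> u \<longleftrightarrow> sine_gordon_solution \<epsilon> \<gamma> (\<lambda>n t. u n)"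

lemma steady_state_iff:
  "steady_state \<epsilon> \<gamma> u \<longleftrightarrow> (\<forall>n. - \<epsilon> * laplacian u n = - sin (u n + theta n) + \<gamma>)"
proof
  assume "steady_state \<epsilon> \<gamma> u"
  then obtain f g where fg: "\<And>n t. ((\<lambda>t. u n) has_real_derivative f n t) (at t)"
      "\<And>n t. (f n has_real_derivative g n t) (at t)"
      "\<And>n t. g n t - \<epsilon> * laplacian u n = - sin (u n + theta n) + \<gamma>"
    unfolding steady_state_def sine_gordon_solution_def by blast
  have "f n t = 0" for n t
    using fg(1) DERIV_const DERIV_unique by blast
  then have "f n = (\<lambda>t. 0)" for n by blast
  then have "g n t = 0" for n t
    using fg(2)[of n t] DERIV_const DERIV_unique by metis
  then show "\<forall>n. - \<epsilon> * laplacian u n = - sin (u n + theta n) + \<gamma>"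
    using fg(3) by simp
next
  assume "\<forall>n. - \<epsilon> * laplacian u n = - sin (u n + theta n) + \<gamma>"
  then show "steady_state \<epsilon> \<gamma> u"
    unfolding steady_state_def sine_gordon_solution_def
    by (intro exI[of _ "\<lambda>n t. 0"]) simp
qed

text \<open>Terms of order less than \<open>\<epsilon>\<close> in the expansion of the kinks at \<open>\<gamma> = 1 - \<epsilon> g\<close>. The argument
  \<open>s\<close> is the sign at site \<open>0\<close>: \<open>-1\<close> for type 1 and \<open>+1\<close> for type 3.\<close>

definition kink_leading :: "real \<Rightarrow> real \<Rightarrow> real \<Rightarrow> int \<Rightarrow> real" where
  "kink_leading s g \<epsilon> n =
     (if n \<le> -1 then pi / 2 - sqrt \<epsilon> * sqrt (2 * g)
      else if n = 0 then pi / 2 + s * (sqrt \<epsilon> * sqrt (2 * (g - pi)))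
      else if n = 1 then 3 * pi / 2 - sqrt \<epsilon> * sqrt (2 * (g + pi))
      else 3 * pi / 2 - sqrt \<epsilon> * sqrt (2 * g))"

text \<open>\<open>\<Phi> n \<epsilon> \<gamma>\<close> is only constrained along \<open>\<gamma> = 1 - \<epsilon> g\<close> for small \<open>\<epsilon> > 0\<close>. The remainder
  \<open>O(\<epsilon>)\<close> is uniform in the site \<open>n\<close>.\<close>

definition kink_family :: "real \<Rightarrow> real \<Rightarrow> (int \<Rightarrow> real \<Rightarrow> real \<Rightarrow> real) \<Rightarrow> bool" where
  "kink_family s g \<Phi> \<longleftrightarrow>
     (\<forall>\<^sub>F \<epsilon> in at_right 0. steady_state \<epsilon> (1 - \<epsilon> * g) (\<lambda>n. \<Phi> n \<epsilon> (1 - \<epsilon> * g))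
                         \<and> mono (\<lambda>n. \<Phi> n \<epsilon> (1 - \<epsilon> * g))) \<and>
     (\<exists>C. \<forall>\<^sub>F \<epsilon> in at_right 0. \<forall>n.
        \<bar>\<Phi> n \<epsilon> (1 - \<epsilon> * g) - kink_leading s g \<epsilon> n\<bar> \<le> C * \<epsilon>)"

definition type1_kink_family :: "real \<Rightarrow> (int \<Rightarrow> real \<Rightarrow> real \<Rightarrow> real) \<Rightarrow> bool" where
  "type1_kink_family = kink_family (-1)"

definition type3_kink_family :: "real \<Rightarrow> (int \<Rightarrow> real \<Rightarrow> real \<Rightarrow> real) \<Rightarrow> bool" where
  "type3_kink_family = kink_family 1"

definition linearization ::
    "(int \<Rightarrow> real \<Rightarrow> real \<Rightarrow> real) \<Rightarrow> real \<Rightarrow> real \<Rightarrow> (int \<Rightarrow> real) \<Rightarrow> int \<Rightarrow> real" where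
  "linearization \<Phi> \<epsilon> \<gamma> v n = \<epsilon> * laplacian v n - cos (\<Phi> n \<epsilon> \<gamma> + theta n) * v n"

definition eigenvalue :: "((int \<Rightarrow> real) \<Rightarrow> int \<Rightarrow> real) \<Rightarrow> real \<Rightarrow> bool" where
  "eigenvalue L \<Lambda> \<longleftrightarrow>
     (\<exists>v. v \<noteq> (\<lambda>n. 0) \<and> (v \<longlongrightarrow> 0) at_top \<and> (v \<longlongrightarrow> 0) at_bot \<and> L v = (\<lambda>n. \<Lambda> * v n))"

definition largest_eigenvalue :: "((int \<Rightarrow> real) \<Rightarrow> int \<Rightarrow> real) \<Rightarrow> real \<Rightarrow> bool" where
  "largest_eigenvalue L \<Lambda> \<longleftrightarrow> eigenvalue L \<Lambda> \<and> (\<forall>\<mu>. eigenvalue L \<mu> \<longrightarrow> \<mu> \<le> \<Lambda>)"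

end

theory Submission
  imports Defs
begin

text \<open>To leading order the potential \<open>- cos (\<Phi> n + \<theta> n)\<close> is \<open>\<surd>\<epsilon>\<close> times a constant
  depending on the site, and it is largest at site \<open>0\<close>, by a gap of order \<open>\<surd>\<epsilon>\<close>. The coupling is
  of order \<open>\<epsilon>\<close>, so it is a perturbation: there is a positive eigenvector peaked at
  site \<open>0\<close>, found as the fixed point of a contraction, whose eigenvalue lies within
  \<open>2 \<epsilon>\<close> below the potential at \<open>0\<close>. The maximum principle off site \<open>0\<close> shows that no eigenvalue
  is larger. The sign of the eigenvalue is thus that of the potential at \<open>0\<close>, which is negative for type 1
  and positive for type 3.\<close>

section \<open>Two tools: a discrete maximum principle and a pointwise fixed point theorem\<close>

lemma decaying_attains_max:
  fixes d :: "int \<Rightarrow> real"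
  assumes top: "(d \<longlongrightarrow> 0) at_top" and bot: "(d \<longlongrightarrow> 0) at_bot" and pos: "d n > 0"
  obtains m where "d m > 0" "\<And>k. d k \<le> d m"
proof -
  obtain N where N: "\<And>k. k \<ge> N \<Longrightarrow> d k < d n"
    using order_tendstoD(2)[OF top pos] by (auto simp: eventually_at_top_linorder)
  obtain M where M: "\<And>k. k \<le> M \<Longrightarrow> d k < d n"
    using order_tendstoD(2)[OF bot pos] by (auto simp: eventually_at_bot_linorder)
  \<comment> \<open>Outside the window all values lie strictly below \<open>d n\<close>, so
    \<open>n\<close> itself is inside and the maximum over the finite window is global.\<close>
  have n: "n \<in> {M..N}"
    using N[of n] M[of n] by (cases "n \<le> M"; cases "n \<ge> N") auto
  have "finite (d ` {M..N})" "d ` {M..N} \<noteq> {}" using n by auto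
  then obtain m where m: "m \<in> {M..N}" "d m = Max (d ` {M..N})"
    using Max_in by (metis imageE)
  have "d k \<le> d m" for k
  proof (cases "k \<in> {M..N}")
    case True
    then show ?thesis by (simp add: m)
  next
    case False
    then have "d k < d n" using N[of k] M[of k] by auto
    also have "d n \<le> d m" using n by (simp add: m)
    finally show ?thesis by simp
  qed
  then show thesis using that pos by (meson less_le_trans)
qed

text \<open>A positive maximum would sit off site 0, which acts as a boundary point. There the
  Laplacian is nonpositive and the potential lies strictly below \<open>\<mu>\<close>, so the
  subsolution inequality \<open>sub\<close> fails.\<close>

lemma punctured_maximum_principle:
  fixes d q :: "int \<Rightarrow> real"
  assumes "(d \<longlongrightarrow> 0) at_top" "(d \<longlongrightarrow> 0) at_bot" and "d 0 \<le> 0" and "\<epsilon> \<ge> 0"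
    and below: "\<And>n. n \<noteq> 0 \<Longrightarrow> q n < \<mu>"
    and sub: "\<And>n. n \<noteq> 0 \<Longrightarrow> \<epsilon> * laplacian d n + q n * d n \<ge> \<mu> * d n"
  shows "d n \<le> 0"
proof (rule ccontr)
  assume "\<not> d n \<le> 0"
  then obtain m where m: "d m > 0" "\<And>k. d k \<le> d m"
    using decaying_attains_max[OF assms(1,2)] by (metis not_le)
  have "m \<noteq> 0" using m \<open>d 0 \<le> 0\<close> by auto
  have "laplacian d m \<le> 0"
    using m(2)[of "m - 1"] m(2)[of "m + 1"] by (simp add: laplacian_def)
  then have "\<epsilon> * laplacian d m \<le> 0"
    using \<open>\<epsilon> \<ge> 0\<close> by (simp add: mult_nonneg_nonpos)
  moreover have "q m * d m < \<mu> * d m"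
    using below[OF \<open>m \<noteq> 0\<close>] m(1) by simp
  ultimately show False using sub[OF \<open>m \<noteq> 0\<close>] by linarith
qed

text \<open>The sup distance enters only through uniform bounds \<open>d\<close>, so no metric on
  \<open>S\<close> is set up. The iterates converge pointwise at a geometric rate uniform in the
  site, which is why closedness under pointwise limits suffices.\<close>

lemma pointwise_Banach_fixed_point:
  fixes T :: "('a \<Rightarrow> real) \<Rightarrow> 'a \<Rightarrow> real"
  assumes start: "x0 \<in> S"
    and closed: "\<And>X x. (\<And>k. X k \<in> S) \<Longrightarrow> (\<And>n. (\<lambda>k. X k n) \<longlonglongrightarrow> x n) \<Longrightarrow> x \<in> S"
    and invariant: "\<And>x. x \<in> S \<Longrightarrow> T x \<in> S"
    and bounded: "\<And>x y n. x \<in> S \<Longrightarrow> y \<in> S \<Longrightarrow> \<bar>x n - y n\<bar> \<le> 1"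
    and contraction: "\<And>x y d n. x \<in> S \<Longrightarrow> y \<in> S \<Longrightarrow> (\<And>m. \<bar>x m - y m\<bar> \<le> d) \<Longrightarrow>
       \<bar>T x n - T y n\<bar> \<le> d / 2"
  obtains x where "x \<in> S" "T x = x"
proof -
  define X where "X k = (T ^^ k) x0" for k
  have X_Suc: "X (Suc k) = T (X k)" for k by (simp add: X_def)
  have XS: "X k \<in> S" for k
    by (induction k) (use start invariant in \<open>auto simp: X_def\<close>)
  \<comment> \<open>Any two points of \<open>S\<close> are within 1, and each application of
    \<open>T\<close> halves the distance. The site stays arbitrary in the induction because
    \<open>T x n\<close> may depend on all values of \<open>x\<close>.\<close>
  have close: "\<bar>X (k + j) n - X k n\<bar> \<le> (1/2) ^ k" for k j n
  proof (induction k arbitrary: n)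
    case 0
    then show ?case using bounded[OF XS XS] by simp
  next
    case (Suc k)
    then show ?case using contraction[OF XS XS Suc] by (simp add: X_Suc)
  qed
  have "convergent (\<lambda>k. X k n)" for n
  proof -
    have "Cauchy (\<lambda>k. X k n)"
    proof (rule CauchyI')
      fix e :: real assume "e > 0"
      then obtain M where M: "(1/2) ^ M < e / 2"
        using real_arch_pow_inv[of "e/2" "1/2"] by auto
      have "dist (X k n) (X l n) < e" if "k \<ge> M" "l > k" for k l
        using close[of M "k - M" n] close[of M "l - M" n] M that 
        by (simp add: dist_real_def abs_if split: if_splits)
      then show "\<exists>M. \<forall>k\<ge>M. \<forall>l>k. dist (X k n) (X l n) < e" by blast
    qed
    then show ?thesis by (simp add: Cauchy_convergent_iff)
  qed
  then obtain x where lim: "\<And>n. (\<lambda>k. X k n) \<longlonglongrightarrow> x n"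
    unfolding convergent_def by metis
  have xS: "x \<in> S" using closed XS lim by blast
  have near: "\<bar>x n - X k n\<bar> \<le> (1/2) ^ k" for n k
  proof (rule LIMSEQ_le_const2)
    show "(\<lambda>j. \<bar>X (k + j) n - X k n\<bar>) \<longlonglongrightarrow> \<bar>x n - X k n\<bar>"
      using LIMSEQ_ignore_initial_segment[OF lim[of n], of k]
      by (intro tendsto_intros) (simp add: add.commute)
  qed (use close in auto)
  have "T x n = x n" for n
  proof (rule LIMSEQ_unique)
    \<comment> \<open>The bound \<open>near\<close> is uniform in the site, so the contraction
      applies to \<open>x\<close> and \<open>X k\<close>; this replaces continuity of
      \<open>T\<close> for pointwise limits.\<close>
    have "(\<lambda>k. T x n - X (Suc k) n) \<longlonglongrightarrow> 0"
    proof (rule tendsto_0_le[where K = "1/2"])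
      show "(\<lambda>k. (1/2 :: real) ^ k) \<longlonglongrightarrow> 0"
        by (rule LIMSEQ_power_zero) simp
      show "\<forall>\<^sub>F k in sequentially. norm (T x n - X (Suc k) n) \<le> norm ((1/2 :: real) ^ k) * (1/2)"
        using contraction[OF xS XS near] by (simp add: X_Suc)
    qed
    from tendsto_diff[OF tendsto_const[of "T x n"] this]
    show "(\<lambda>k. X (Suc k) n) \<longlonglongrightarrow> T x n" by simp
    show "(\<lambda>k. X (Suc k) n) \<longlonglongrightarrow> x n" using lim by (rule LIMSEQ_Suc)
  qed
  then show thesis using that xS by blast
qed

section \<open>Positive eigenvector for a potential peaked at site 0\<close>

definition geometric_profiles :: "(int \<Rightarrow> real) set" where
  "geometric_profiles = {v. v 0 = 1 \<and> (\<forall>n. 0 \<le> v n \<and> v n \<le> (1/2) ^ nat \<bar>n\<bar>)}"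

lemma geometric_profile_decays:
  assumes "v \<in> geometric_profiles"
  shows "(v \<longlongrightarrow> 0) at_top" "(v \<longlongrightarrow> 0) at_bot"
proof -
  have bound: "norm (v n) \<le> (1/2) ^ nat \<bar>n\<bar>" for n
    using assms by (simp add: geometric_profiles_def)
  have geo: "(\<lambda>k. (1/2 :: real) ^ k) \<longlonglongrightarrow> 0" by (rule LIMSEQ_power_zero) simp
  have "filterlim (\<lambda>n::int. nat \<bar>n\<bar>) sequentially at_top"
    by (rule filterlim_at_top_mono[OF filterlim_nat_sequentially]) (auto intro!: always_eventually)
  from filterlim_compose[OF geo this] show "(v \<longlongrightarrow> 0) at_top"
    by (rule tendsto_0_le[where K = 1]) (use bound in \<open>auto intro!: always_eventually\<close>)
  have "filterlim (\<lambda>n::int. nat \<bar>n\<bar>) sequentially at_bot"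
    unfolding filterlim_at_top eventually_at_bot_linorder
    by (intro allI, rule_tac x="- int Z" in exI) auto
  from filterlim_compose[OF geo this] show "(v \<longlongrightarrow> 0) at_bot"
    by (rule tendsto_0_le[where K = 1]) (use bound in \<open>auto intro!: always_eventually\<close>)
qed

text \<open>The neighbour closer to site 0 has twice the bound valid at \<open>n\<close>, the
  farther one half of it: 5/2 = 2 + 1/2.\<close>

lemma geometric_profile_neighbours:
  assumes "v \<in> geometric_profiles" "n \<noteq> 0"
  shows "v (n - 1) + v (n + 1) \<le> 5/2 * (1/2) ^ nat \<bar>n\<bar>"
proof -
  have le: "v m \<le> (1/2) ^ nat \<bar>m\<bar>" for m
    using assms by (simp add: geometric_profiles_def)
  obtain k where "n = int (Suc k) \<or> n = - int (Suc k)"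
    using \<open>n \<noteq> 0\<close> by (metis int_cases3 gr0_conv_Suc)
  then show ?thesis
  proof
    assume n: "n = int (Suc k)"
    have "nat \<bar>n - 1\<bar> = k" "nat \<bar>n\<bar> = Suc k" "nat \<bar>n + 1\<bar> = Suc (Suc k)"
      using n by auto
    then show ?thesis using le[of "n - 1"] le[of "n + 1"] by simp
  next
    assume n: "n = - int (Suc k)"
    have "nat \<bar>n + 1\<bar> = k" "nat \<bar>n\<bar> = Suc k" "nat \<bar>n - 1\<bar> = Suc (Suc k)"
      using n by auto
    then show ?thesis using le[of "n - 1"] le[of "n + 1"] by simp
  qed
qed

text \<open>Changing numerator and denominator separately costs at most \<open>d / 4\<close> and
  \<open>d / 16\<close>: the denominators are at least four times the bound
  \<open>2 * \<epsilon>\<close> on the numerator \<open>a'\<close> and on the increments per unit of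
  \<open>d\<close>.\<close>

lemma quotient_contraction:
  fixes a a' b b' \<epsilon> d :: real
  assumes "\<epsilon> > 0" and b: "b \<ge> 8 * \<epsilon>" "b' \<ge> 8 * \<epsilon>" and a': "0 \<le> a'" "a' \<le> 2 * \<epsilon>"
    and da: "\<bar>a - a'\<bar> \<le> 2 * \<epsilon> * d" and db: "\<bar>b - b'\<bar> \<le> 2 * \<epsilon> * d"
  shows "\<bar>a / b - a' / b'\<bar> \<le> d / 2"
proof -
  have pos: "b > 0" "b' > 0" using assms by linarith+
  have d: "d \<ge> 0" 
    using da \<open>\<epsilon> > 0\<close> by (smt (verit) mult_neg_pos mult_pos_neg zero_le_mult_iff)
  have "a / b - a' / b' = (a - a') / b + a' / b' * ((b' - b) / b)"
    using pos by (simp add: field_simps)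
  also have "\<bar>\<dots>\<bar> \<le> \<bar>a - a'\<bar> / b + a' / b' * (\<bar>b - b'\<bar> / b)"
    using pos a' by (intro order_trans[OF abs_triangle_ineq]) (simp add: abs_mult abs_minus_commute)
  also have "\<dots> \<le> d / 4 + 1/4 * (d / 4)"
  proof (intro add_mono mult_mono)
    have *: "2 * \<epsilon> * d \<le> d / 4 * b"
      using mult_left_mono[OF b(1) d] by (simp add: mult_ac)
    show "\<bar>a - a'\<bar> / b \<le> d / 4" "\<bar>b - b'\<bar> / b \<le> d / 4"
      using da db * pos by (simp_all add: pos_divide_le_eq)
    show "a' / b' \<le> 1/4" using a' b pos by (simp add: pos_divide_le_eq)
  qed (use pos in auto)
  finally show ?thesis using d by linarith
qed

text \<open>The set \<open>geometric_profiles\<close> builds in the normalisation at site 0, the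
  sign and the decay of the eigenvector, and is closed under pointwise limits. The gap
  \<open>8 * \<epsilon>\<close> keeps the set invariant and also makes the map a
  contraction.\<close>

lemma peak_ground_state:
  fixes q :: "int \<Rightarrow> real"
  assumes "\<epsilon> > 0" and gap: "\<And>n. n \<noteq> 0 \<Longrightarrow> q n + 8 * \<epsilon> \<le> q 0"
  obtains v \<Lambda> where "v \<in> geometric_profiles" "q 0 - 2 * \<epsilon> \<le> \<Lambda>" "\<Lambda> \<le> q 0"
    "\<And>n. \<epsilon> * laplacian v n + q n * v n = \<Lambda> * v n"
proof -
  \<comment> \<open>The eigenvalue equation at site \<open>0\<close>, with \<open>v 0 = 1\<close>, determines the eigenvalue; substituting it into
    the equations at the other sites gives \<open>T\<close>.\<close>
  define T where "T v n = (if n = 0 then 1 else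
      \<epsilon> * (v (n - 1) + v (n + 1)) / (q 0 - q n + \<epsilon> * (v 1 + v (- 1))))" for v n
  let ?S = geometric_profiles
  have nonneg: "0 \<le> v n" if "v \<in> ?S" for v n
    using that by (simp add: geometric_profiles_def)
  have le1: "v n \<le> 1" if "v \<in> ?S" for v n
    using that power_le_one[of "1/2::real" "nat \<bar>n\<bar>"]
    unfolding geometric_profiles_def by (smt (verit) mem_Collect_eq half_gt_zero_iff field_sum_of_halves)
  have halves: "v 1 \<le> 1/2" "v (- 1) \<le> 1/2" if "v \<in> ?S" for v
    using that by (auto simp: geometric_profiles_def dest: spec[of _ 1] spec[of _ "-1"])
  have den: "q 0 - q n + \<epsilon> * (v 1 + v (- 1)) \<ge> 8 * \<epsilon>" if "v \<in> ?S" "n \<noteq> 0" for v n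
    using gap[OF that(2)] nonneg[OF that(1)] \<open>\<epsilon> > 0\<close> by (smt (verit) mult_nonneg_nonneg)
  obtain v where v: "v \<in> ?S" and fix_v: "T v = v"
  proof (rule pointwise_Banach_fixed_point[where S = ?S and T = T])
    show "(\<lambda>n. if n = 0 then 1 else 0) \<in> ?S"
      by (simp add: geometric_profiles_def)
  next
    fix X :: "nat \<Rightarrow> int \<Rightarrow> real" and x
    assume X: "\<And>k. X k \<in> ?S" and lim: "\<And>n. (\<lambda>k. X k n) \<longlonglongrightarrow> x n"
    have "x 0 = 1"
      using X lim[of 0] by (simp add: geometric_profiles_def LIMSEQ_const_iff)
    moreover have "0 \<le> x n" for n
      using X by (intro LIMSEQ_le_const[OF lim]) (auto simp: geometric_profiles_def)
    moreover have "x n \<le> (1/2) ^ nat \<bar>n\<bar>" for n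
      using X by (intro LIMSEQ_le_const2[OF lim]) (auto simp: geometric_profiles_def)
    ultimately show "x \<in> ?S" by (simp add: geometric_profiles_def)
  next
    fix x assume x: "x \<in> ?S"
    have "0 \<le> T x n \<and> T x n \<le> (1/2) ^ nat \<bar>n\<bar>" for n
    proof (cases "n = 0")
      case False
      note D = den[OF x False]
      \<comment> \<open>The geometric bound survives because the neighbour constant 5/2 is below the
        denominator constant 8.\<close>
      have "\<epsilon> * (x (n - 1) + x (n + 1)) \<le> \<epsilon> * (5/2 * (1/2) ^ nat \<bar>n\<bar>)"
        using geometric_profile_neighbours[OF x False] \<open>\<epsilon> > 0\<close> by simp
      also have "\<dots> \<le> (1/2) ^ nat \<bar>n\<bar> * (8 * \<epsilon>)"
        using \<open>\<epsilon> > 0\<close> by simp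
      also have "\<dots> \<le> (1/2) ^ nat \<bar>n\<bar> * (q 0 - q n + \<epsilon> * (x 1 + x (- 1)))"
        using D by (intro mult_left_mono) auto
      finally show ?thesis
        using D nonneg[OF x] \<open>\<epsilon> > 0\<close> False by (simp add: T_def pos_divide_le_eq)
    qed (simp add: T_def)
    then show "T x \<in> ?S" by (simp add: geometric_profiles_def T_def)
  next
    fix x y :: "int \<Rightarrow> real" and n
    assume "x \<in> ?S" "y \<in> ?S"
    then show "\<bar>x n - y n\<bar> \<le> 1"
      using nonneg[of x n] nonneg[of y n] le1[of x n] le1[of y n] by linarith
  next
    fix x y :: "int \<Rightarrow> real" and d n
    assume x: "x \<in> ?S" and y: "y \<in> ?S" and d: "\<And>m. \<bar>x m - y m\<bar> \<le> d"
    have two: "\<bar>\<epsilon> * (x j + x k) - \<epsilon> * (y j + y k)\<bar> \<le> 2 * \<epsilon> * d" for j k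
    proof -
      have "\<bar>\<epsilon> * (x j + x k) - \<epsilon> * (y j + y k)\<bar> = \<epsilon> * \<bar>(x j - y j) + (x k - y k)\<bar>"
        using \<open>\<epsilon> > 0\<close> by (simp add: abs_mult flip: right_diff_distrib)
      also have "\<dots> \<le> \<epsilon> * (2 * d)"
        using d[of j] d[of k] \<open>\<epsilon> > 0\<close> by (intro mult_left_mono) auto
      finally show ?thesis by simp
    qed
    show "\<bar>T x n - T y n\<bar> \<le> d / 2"
    proof (cases "n = 0")
      case True
      then show ?thesis using d[of 0] by (simp add: T_def)
    next
      case False
      have "\<epsilon> * (y (n - 1) + y (n + 1)) \<le> \<epsilon> * 2"
        using le1[OF y, of "n - 1"] le1[OF y, of "n + 1"] \<open>\<epsilon> > 0\<close> by (intro mult_left_mono) auto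
      then have "\<bar>\<epsilon> * (x (n - 1) + x (n + 1)) / (q 0 - q n + \<epsilon> * (x 1 + x (- 1))) -
          \<epsilon> * (y (n - 1) + y (n + 1)) / (q 0 - q n + \<epsilon> * (y 1 + y (- 1)))\<bar> \<le> d / 2"
        using two[of 1 "-1"] two nonneg[OF y] \<open>\<epsilon> > 0\<close>
        by (intro quotient_contraction[of \<epsilon>] den x y False) auto
      then show ?thesis using False by (simp add: T_def)
    qed
  qed
  \<comment> \<open>This is the equation at site 0 with \<open>v 0 = 1\<close>. Both neighbours lie
    between 0 and 1/2, which places \<open>\<Lambda>\<close> within \<open>2 * \<epsilon>\<close>
    below \<open>q 0\<close>.\<close>
  define \<Lambda> where "\<Lambda> = q 0 + \<epsilon> * (v 1 + v (- 1) - 2)"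
  show thesis
  proof
    show "v \<in> ?S" by (fact v)
    show "q 0 - 2 * \<epsilon> \<le> \<Lambda>"
      using nonneg[OF v] \<open>\<epsilon> > 0\<close> by (simp add: \<Lambda>_def algebra_simps)
    have "\<epsilon> * (v 1 + v (- 1) - 2) \<le> 0"
      using halves[OF v] \<open>\<epsilon> > 0\<close> by (intro mult_nonneg_nonpos) auto
    then show "\<Lambda> \<le> q 0" by (simp add: \<Lambda>_def)
    show "\<epsilon> * laplacian v n + q n * v n = \<Lambda> * v n" for n
    proof (cases "n = 0")
      case True
      then show ?thesis using v
        by (simp add: geometric_profiles_def laplacian_def \<Lambda>_def algebra_simps)
    next
      case False
      have "q 0 - q n + \<epsilon> * (v 1 + v (- 1)) > 0"
        using den[OF v False] \<open>\<epsilon> > 0\<close> by linarith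
      moreover have "v n = \<epsilon> * (v (n - 1) + v (n + 1)) / (q 0 - q n + \<epsilon> * (v 1 + v (- 1)))"
        using fun_cong[OF fix_v, of n] False by (simp add: T_def)
      ultimately have "v n * (q 0 - q n + \<epsilon> * (v 1 + v (- 1))) = \<epsilon> * (v (n - 1) + v (n + 1))"
        by (simp add: eq_divide_eq)
      \<comment> \<open>The term \<open>- 2 * \<epsilon> * v n\<close> occurs both in the Laplacian
        and in \<open>\<Lambda> * v n\<close> and cancels.\<close>
      then show ?thesis by (simp add: laplacian_def \<Lambda>_def algebra_simps)
    qed
  qed
qed

section \<open>Maximality of the eigenvalue\<close>

lemma laplacian_scale: "laplacian (\<lambda>n. c * v n) n = c * laplacian v n"
  by (simp add: laplacian_def algebra_simps)

lemma laplacian_diff: "laplacian (\<lambda>n. v n - w n) n = laplacian v n - laplacian w n"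
  by (simp add: laplacian_def algebra_simps)

lemma peak_largest_eigenvalue:
  fixes q :: "int \<Rightarrow> real"
  assumes "\<epsilon> > 0" and gap: "\<And>n. n \<noteq> 0 \<Longrightarrow> q n + 8 * \<epsilon> \<le> q 0"
  obtains \<Lambda> where "largest_eigenvalue (\<lambda>v n. \<epsilon> * laplacian v n + q n * v n) \<Lambda>"
    "q 0 - 2 * \<epsilon> \<le> \<Lambda>" "\<Lambda> \<le> q 0"
proof -
  obtain v \<Lambda> where v: "v \<in> geometric_profiles" and \<Lambda>: "q 0 - 2 * \<epsilon> \<le> \<Lambda>" "\<Lambda> \<le> q 0"
    and eq: "\<And>n. \<epsilon> * laplacian v n + q n * v n = \<Lambda> * v n"
    using peak_ground_state[of \<epsilon> q] assms by blast
  let ?L = "\<lambda>v n. \<epsilon> * laplacian v n + q n * v n"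
  have v0: "v 0 = 1" and v_nonneg: "\<And>n. v n \<ge> 0"
    using v by (auto simp: geometric_profiles_def)
  have "v \<noteq> (\<lambda>n. 0)" using v0 by (metis zero_neq_one)
  then have ev: "eigenvalue ?L \<Lambda>"
    unfolding eigenvalue_def using geometric_profile_decays[OF v] eq by blast
  have "\<mu> \<le> \<Lambda>" if \<mu>: "eigenvalue ?L \<mu>" for \<mu>
  proof (rule ccontr)
    assume "\<not> \<mu> \<le> \<Lambda>"
    \<comment> \<open>Off site 0 the potential is at most \<open>q 0 - 8 * \<epsilon>\<close>,
      whereas \<open>\<mu>\<close> exceeds \<open>\<Lambda>\<close>, which is at least
      \<open>q 0 - 2 * \<epsilon>\<close>. Hence the maximum principle applies with
      \<open>\<mu>\<close>.\<close>
    then have below: "q n < \<mu>" if "n \<noteq> 0" for n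
      using gap[OF that] \<Lambda> \<open>\<epsilon> > 0\<close> by linarith
    obtain w where "w \<noteq> (\<lambda>n. 0)" and wt: "(w \<longlongrightarrow> 0) at_top" and wb: "(w \<longlongrightarrow> 0) at_bot"
      and "?L w = (\<lambda>n. \<mu> * w n)"
      using \<mu> unfolding eigenvalue_def by blast
    then have w: "?L w n = \<mu> * w n" for n by metis
    have scaled: "?L (\<lambda>n. c * w n) n = \<mu> * (c * w n)" for c n
      using arg_cong[OF w[of n], of "\<lambda>t. c * t"] by (simp add: laplacian_scale algebra_simps)
    \<comment> \<open>An eigenvector vanishing at site 0 would vanish everywhere, by the maximum
      principle for both \<open>w\<close> and \<open>- w\<close>.\<close>
    have "w 0 \<noteq> 0"
    proof
      assume "w 0 = 0"
      have "c * w n \<le> 0" for c n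
      proof (rule punctured_maximum_principle[where \<mu> = \<mu> and q = q and \<epsilon> = \<epsilon>])
        show "((\<lambda>n. c * w n) \<longlongrightarrow> 0) at_top" "((\<lambda>n. c * w n) \<longlongrightarrow> 0) at_bot"
          using wt wb by (auto intro: tendsto_mult_right_zero)
      qed (use \<open>w 0 = 0\<close> \<open>\<epsilon> > 0\<close> below scaled in auto)
      from this[of 1] this[of "-1"] have "w n = 0" for n by (simp add: order_antisym)
      then show False using \<open>w \<noteq> (\<lambda>n. 0)\<close> by blast
    qed
    \<comment> \<open>With both eigenvectors normalised at \<open>0\<close>, the one for the larger eigenvalue is smaller elsewhere,
      which the equation at \<open>0\<close> rules out.\<close>
    define d where "d n = 1 / w 0 * w n - v n" for n
    have d0: "d 0 = 0" using \<open>w 0 \<noteq> 0\<close> v0 by (simp add: d_def)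
    \<comment> \<open>The forcing \<open>(\<mu> - \<Lambda>) * v n\<close> is nonnegative, so
      \<open>d\<close> is a subsolution; at site 0 it equals \<open>\<mu> - \<Lambda> > 0\<close>,
      the source of the contradiction.\<close>
    have Ld: "?L d n = \<mu> * d n + (\<mu> - \<Lambda>) * v n" for n
    proof -
      have "?L d n = ?L (\<lambda>n. 1 / w 0 * w n) n - ?L v n"
        unfolding d_def laplacian_diff by (simp only: algebra_simps)
      also have "\<dots> = \<mu> * (1 / w 0 * w n) - \<Lambda> * v n" by (simp only: scaled eq)
      finally show ?thesis by (simp add: d_def algebra_simps)
    qed
    have "d n \<le> 0" for n
    proof (rule punctured_maximum_principle[where \<mu> = \<mu> and q = q and \<epsilon> = \<epsilon>])
      have "((\<lambda>n. 1 / w 0 * w n - v n) \<longlongrightarrow> 0 - 0) at_top"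
        by (intro tendsto_diff tendsto_mult_right_zero wt geometric_profile_decays v)
      then show "(d \<longlongrightarrow> 0) at_top" by (simp add: d_def[abs_def])
      have "((\<lambda>n. 1 / w 0 * w n - v n) \<longlongrightarrow> 0 - 0) at_bot"
        by (intro tendsto_diff tendsto_mult_right_zero wb geometric_profile_decays v)
      then show "(d \<longlongrightarrow> 0) at_bot" by (simp add: d_def[abs_def])
    qed (use d0 \<open>\<epsilon> > 0\<close> below Ld v_nonneg \<open>\<not> \<mu> \<le> \<Lambda>\<close> in auto)
    then have "laplacian d 0 \<le> 0"
      using d0 by (simp add: laplacian_def add_nonpos_nonpos)
    then have "?L d 0 \<le> 0" using d0 \<open>\<epsilon> > 0\<close> by (simp add: mult_nonneg_nonpos)
    then show False using Ld[of 0] d0 v0 \<open>\<not> \<mu> \<le> \<Lambda>\<close> by simp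
  qed
  with ev show thesis using that \<Lambda> unfolding largest_eigenvalue_def by blast
qed

section \<open>Asymptotics of the potential along the kinks\<close>

definition kink_slope :: "real \<Rightarrow> real \<Rightarrow> int \<Rightarrow> real" where
  "kink_slope s g n =
     (if n = 0 then - s * sqrt (2 * (g - pi))
      else if n = 1 then sqrt (2 * (g + pi)) else sqrt (2 * g))"

text \<open>Adding \<open>theta\<close> removes the jump of the kink, so the phase is near pi/2 at
  every site. The sign of \<open>kink_slope\<close> is chosen so that it is the coefficient of
  \<open>sqrt \<epsilon>\<close> in the cosine.\<close>

lemma kink_leading_conv_slope:
  "kink_leading s g \<epsilon> n = pi / 2 - theta n - sqrt \<epsilon> * kink_slope s g n"
  by (auto simp: kink_leading_def kink_slope_def theta_def)

lemma abs_sin_minus_arg_le: "\<bar>sin x - x\<bar> \<le> x\<^sup>2" for x :: real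
proof -
  have "\<bar>sin x - x\<bar> \<le> x\<^sup>2 / 2"
    using Maclaurin_sin_bound[of x 2] by (simp add: numeral_2_eq_2 sin_coeff_def)
  then show ?thesis by (smt (verit) field_sum_of_halves zero_le_power2)
qed

text \<open>The cosine is the sine of \<open>?y\<close>, the distance of the phase below pi/2. Since
  \<open>?y\<close> is of order \<open>sqrt \<epsilon>\<close>, replacing the sine by its argument
  costs only order \<open>\<epsilon>\<close>. Uniformity in the site comes from the common bound
  \<open>A\<close> on the slopes.\<close>

lemma kink_cos_expansion:
  assumes "g > pi" "\<bar>s\<bar> \<le> 1" and \<Phi>: "kink_family s g \<Phi>"
  obtains C where "C > 0" "\<forall>\<^sub>F \<epsilon> in at_right 0. \<forall>n.
    \<bar>cos (\<Phi> n \<epsilon> (1 - \<epsilon> * g) + theta n) - sqrt \<epsilon> * kink_slope s g n\<bar> \<le> C * \<epsilon>"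
proof -
  obtain C where C: "\<forall>\<^sub>F \<epsilon> in at_right 0. \<forall>n.
      \<bar>\<Phi> n \<epsilon> (1 - \<epsilon> * g) - kink_leading s g \<epsilon> n\<bar> \<le> C * \<epsilon>"
    using \<Phi> unfolding kink_family_def by blast
  define A where "A = sqrt (2 * (g + pi))"
  have A: "\<bar>kink_slope s g n\<bar> \<le> A" for n
  proof -
    have "\<bar>s\<bar> * sqrt (2 * (g - pi)) \<le> 1 * sqrt (2 * (g + pi))"
      using assms pi_gt_zero by (intro mult_mono real_sqrt_le_mono) auto
    moreover have "0 \<le> sqrt (2 * g)" "sqrt (2 * g) \<le> A" "0 \<le> A"
      using \<open>g > pi\<close> pi_gt_zero by (auto simp: A_def simp del: pi_gt_zero)
    ultimately show ?thesis
      using assms by (auto simp: kink_slope_def A_def abs_mult)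
  qed
  have small: "\<forall>\<^sub>F \<epsilon>::real in at_right 0. 0 < \<epsilon> \<and> \<epsilon> < 1"
    using eventually_at_right_real[of 0 1] by (simp add: eventually_at_right_real)
  \<comment> \<open>The constant adds the error of the kink expansion, where \<open>C\<close> may be
    negative, and the quadratic error of the sine; the summand 1 makes positivity immediate.\<close>
  have "\<forall>\<^sub>F \<epsilon> in at_right 0. \<forall>n.
    \<bar>cos (\<Phi> n \<epsilon> (1 - \<epsilon> * g) + theta n) - sqrt \<epsilon> * kink_slope s g n\<bar> \<le> (\<bar>C\<bar> + (A + \<bar>C\<bar>)\<^sup>2 + 1) * \<epsilon>"
    using C small
  proof eventually_elim
    case (elim \<epsilon>)
    show ?case
    proof
      fix n
      let ?y = "pi / 2 - (\<Phi> n \<epsilon> (1 - \<epsilon> * g) + theta n)" and ?a = "kink_slope s g n"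
      have \<epsilon>: "0 < \<epsilon>" "\<epsilon> < 1" using elim by auto
      have "\<bar>?y - sqrt \<epsilon> * ?a\<bar> \<le> C * \<epsilon>"
        using elim(1)[rule_format, of n] unfolding kink_leading_conv_slope by linarith
      also have "\<dots> \<le> \<bar>C\<bar> * \<epsilon>" using \<epsilon> by (intro mult_right_mono) auto
      finally have y: "\<bar>?y - sqrt \<epsilon> * ?a\<bar> \<le> \<bar>C\<bar> * \<epsilon>" .
      have "\<epsilon> \<le> sqrt \<epsilon>" using \<epsilon> by (intro real_le_rsqrt) (simp add: power2_eq_square)
      then have "\<bar>C\<bar> * \<epsilon> \<le> \<bar>C\<bar> * sqrt \<epsilon>" by (intro mult_left_mono) auto
      moreover have "\<bar>sqrt \<epsilon> * ?a\<bar> \<le> A * sqrt \<epsilon>"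
        using A[of n] \<epsilon> by (simp add: abs_mult mult.commute)
      ultimately have "\<bar>?y\<bar> \<le> (A + \<bar>C\<bar>) * sqrt \<epsilon>"
        using y unfolding distrib_right by linarith
      then have "?y\<^sup>2 \<le> ((A + \<bar>C\<bar>) * sqrt \<epsilon>)\<^sup>2"
        by (metis abs_ge_zero power2_abs power_mono)
      also have "\<dots> = (A + \<bar>C\<bar>)\<^sup>2 * \<epsilon>" using \<epsilon> by (simp add: power_mult_distrib)
      finally have "\<bar>sin ?y - ?y\<bar> \<le> (A + \<bar>C\<bar>)\<^sup>2 * \<epsilon>"
        using abs_sin_minus_arg_le[of ?y] by linarith
      then have "\<bar>sin ?y - sqrt \<epsilon> * ?a\<bar> \<le> (\<bar>C\<bar> + (A + \<bar>C\<bar>)\<^sup>2 + 1) * \<epsilon>"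
        using y \<epsilon> unfolding distrib_right by linarith
      then show "\<bar>cos (\<Phi> n \<epsilon> (1 - \<epsilon> * g) + theta n) - sqrt \<epsilon> * ?a\<bar> \<le> (\<bar>C\<bar> + (A + \<bar>C\<bar>)\<^sup>2 + 1) * \<epsilon>"
        by (simp add: cos_sin_eq)
    qed
  qed
  moreover have "\<bar>C\<bar> + (A + \<bar>C\<bar>)\<^sup>2 + 1 > 0" by (smt (verit) zero_le_power2)
  ultimately show thesis using that by blast
qed

text \<open>This lets leading terms of order \<open>sqrt \<epsilon>\<close> absorb all errors of
  order \<open>\<epsilon>\<close>.\<close>

lemma eventually_linear_less_sqrt:
  fixes K \<delta> :: real
  assumes "\<delta> > 0"
  shows "\<forall>\<^sub>F \<epsilon> in at_right 0. K * \<epsilon> < \<delta> * sqrt \<epsilon>"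
proof -
  have "((\<lambda>\<epsilon>. K * sqrt \<epsilon>) \<longlongrightarrow> K * sqrt 0) (at_right 0)"
    by (intro tendsto_intros)
  then have "\<forall>\<^sub>F \<epsilon> in at_right 0. K * sqrt \<epsilon> < \<delta>"
    using assms by (intro order_tendstoD(2)) auto
  moreover have "\<forall>\<^sub>F \<epsilon>::real in at_right 0. \<epsilon> > 0" by (simp add: eventually_at_filter)
  ultimately show ?thesis
  proof eventually_elim
    case (elim \<epsilon>)
    then have "K * sqrt \<epsilon> * sqrt \<epsilon> < \<delta> * sqrt \<epsilon>" by simp
    then show ?case using elim by (simp add: mult.assoc)
  qed
qed

text \<open>Both types are treated at once, since the leading potential at site 0 is
  \<open>s * \<eta> * sqrt \<epsilon>\<close> and so carries the sign \<open>s\<close>.\<close>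

lemma kink_largest_eigenvalue:
  assumes "g > pi" "\<bar>s\<bar> = 1" and \<Phi>: "kink_family s g \<Phi>"
  shows "\<forall>\<^sub>F \<epsilon> in at_right 0. \<exists>\<Lambda>.
    largest_eigenvalue (linearization \<Phi> \<epsilon> (1 - \<epsilon> * g)) \<Lambda> \<and> s * \<Lambda> > 0"
proof -
  obtain C where "C > 0" and C: "\<forall>\<^sub>F \<epsilon> in at_right 0. \<forall>n.
    \<bar>cos (\<Phi> n \<epsilon> (1 - \<epsilon> * g) + theta n) - sqrt \<epsilon> * kink_slope s g n\<bar> \<le> C * \<epsilon>"
    using kink_cos_expansion[OF \<open>g > pi\<close> _ \<Phi>] assms by auto
  \<comment> \<open>This is the slope gap for type 1, the smaller of the two; for type 3 the slope
    at site 0 is negative.\<close>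
  define \<delta> where "\<delta> = sqrt (2 * g) - sqrt (2 * (g - pi))"
  define \<eta> where "\<eta> = sqrt (2 * (g - pi))"
  have "\<delta> > 0" "\<eta> > 0" using \<open>g > pi\<close> pi_gt_zero by (auto simp: \<delta>_def \<eta>_def)
  have s: "s = 1 \<or> s = - 1" using \<open>\<bar>s\<bar> = 1\<close> by linarith
  have slope0: "kink_slope s g 0 = - s * \<eta>" by (simp add: kink_slope_def \<eta>_def)
  have slope: "kink_slope s g n \<ge> kink_slope s g 0 + \<delta>" if "n \<noteq> 0" for n
  proof -
    have "kink_slope s g 0 \<le> \<eta>" using s \<open>\<eta> > 0\<close> by (auto simp: slope0)
    moreover have "kink_slope s g n \<ge> sqrt (2 * g)"
      using that pi_gt_zero by (simp add: kink_slope_def)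
    ultimately show ?thesis by (simp add: \<delta>_def \<eta>_def)
  qed
  have pos: "\<forall>\<^sub>F \<epsilon>::real in at_right 0. \<epsilon> > 0" by (simp add: eventually_at_filter)
  \<comment> \<open>The gap \<open>8 * \<epsilon>\<close> must survive the expansion errors at two
    sites, hence \<open>2 * C + 8\<close>. The sign must survive one such error and the shift of
    \<open>\<Lambda>\<close> from \<open>q 0\<close>, hence \<open>C + 2\<close>.\<close>
  show ?thesis
    using C pos eventually_linear_less_sqrt[OF \<open>\<delta> > 0\<close>, of "2 * C + 8"]
      eventually_linear_less_sqrt[OF \<open>\<eta> > 0\<close>, of "C + 2"]
  proof eventually_elim
    case (elim \<epsilon>)
    define q where "q n = - cos (\<Phi> n \<epsilon> (1 - \<epsilon> * g) + theta n)" for n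
    have q: "\<bar>q n + sqrt \<epsilon> * kink_slope s g n\<bar> \<le> C * \<epsilon>" for n
      using elim(1)[rule_format, of n] unfolding q_def by linarith
    have "q n + 8 * \<epsilon> \<le> q 0" if "n \<noteq> 0" for n
    proof -
      have "sqrt \<epsilon> * (kink_slope s g 0 + \<delta>) \<le> sqrt \<epsilon> * kink_slope s g n"
        using slope[OF that] elim by (intro mult_left_mono) auto
      then show ?thesis
        using q[of 0] q[of n] elim(3) by (simp add: algebra_simps abs_le_iff)
    qed
    then obtain \<Lambda> where \<Lambda>: "largest_eigenvalue (\<lambda>v n. \<epsilon> * laplacian v n + q n * v n) \<Lambda>"
      "q 0 - 2 * \<epsilon> \<le> \<Lambda>" "\<Lambda> \<le> q 0"
      using peak_largest_eigenvalue[of \<epsilon> q] elim by blast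
    have "linearization \<Phi> \<epsilon> (1 - \<epsilon> * g) = (\<lambda>v n. \<epsilon> * laplacian v n + q n * v n)"
      by (intro ext) (simp add: linearization_def q_def)
    moreover have "s * \<Lambda> > 0"
      using s \<Lambda>(2,3) q[of 0] elim(2,4) \<open>C > 0\<close>
      by (auto simp: slope0 algebra_simps abs_le_iff)
    ultimately show ?case using \<Lambda>(1) by metis
  qed
qed

theorem lemma5p4:
  fixes g :: real and \<Phi>1 \<Phi>3 :: "int \<Rightarrow> real \<Rightarrow> real \<Rightarrow> real"
  assumes "g > pi"
    and "type1_kink_family g \<Phi>1"
    and "type3_kink_family g \<Phi>3"
  shows "\<exists>\<epsilon>0>0. \<forall>\<epsilon>. 0 < \<epsilon> \<and> \<epsilon> < \<epsilon>0 \<longrightarrow>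
           (\<exists>\<Lambda>. largest_eigenvalue (linearization \<Phi>1 \<epsilon> (1 - \<epsilon> * g)) \<Lambda> \<and> \<Lambda> < 0) \<and>
           (\<exists>\<Lambda>. largest_eigenvalue (linearization \<Phi>3 \<epsilon> (1 - \<epsilon> * g)) \<Lambda> \<and> \<Lambda> > 0)"
proof -
  have "\<forall>\<^sub>F \<epsilon> in at_right 0.
      (\<exists>\<Lambda>. largest_eigenvalue (linearization \<Phi>1 \<epsilon> (1 - \<epsilon> * g)) \<Lambda> \<and> \<Lambda> < 0) \<and>
      (\<exists>\<Lambda>. largest_eigenvalue (linearization \<Phi>3 \<epsilon> (1 - \<epsilon> * g)) \<Lambda> \<and> \<Lambda> > 0)"
    using kink_largest_eigenvalue[of g "-1" \<Phi>1] kink_largest_eigenvalue[of g 1 \<Phi>3] assms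
    by (auto simp: type1_kink_family_def type3_kink_family_def intro: eventually_conj)
  then show ?thesis unfolding eventually_at_right_field by blast
qed

end
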